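(* Let $H$ be a complex Hilbert space, $A$ a closed densely defined linear operator on $H$ with $\mathrm i\mathbb R\subset\varrho(A)$, and $B$ a symmetric (densely defined) linear operator on $H$ with $\mathcal D(A^* )\subset\mathcal D(B)$. Consider the assertions (i) $\ker B=\{0\}$; (ii) $\bigcap_{t\in\mathbb R}\ker\bigl(B(A^*+\mathrm it)^{-1}\bigr)=\{0\}$; (iii) $\overline{\operatorname{span}\{(A-\mathrm it)^{-1}B^*u\mid t\in\mathbb R,\ u\in\mathcal D(B^* )\}}=H$; (iv) for all $\lambda\in\sigma_p(A^* )$: $\ker B\cap\ker(A^*-\lambda)=\{0\}$. Then (i) $\Longrightarrow$ (ii) $\Longleftrightarrow$ (iii) $\Longrightarrow$ (iv). If, in addition, $A$ has compact resolvent and possesses a complete system of generalised eigenvectors, then even (iii) $\Longleftrightarrow$ (iv).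
   Context: $\mathcal D(\cdot)$ denotes the domain, $\varrho(\cdot)$ the resolvent set, $\sigma_p(\cdot)$ the point spectrum (set of eigenvalues). A generalised eigenvector of $A$ at $\lambda\in\sigma_p(A)$ is a nonzero element of $\ker(A-\lambda)^n$ for some $n\ge1$; the system of generalised eigenvectors is complete if its linear span is dense in $H$. *)

theory Defs
  imports "HOL-Analysis.Analysis"
begin

text \<open>
  Complex inner product spaces, built on top of the real inner product space with
  inner product \<open>Re \<langle>x, y\<rangle>\<close>.  The latter determines norm and topology, and its axioms supply
  positive definiteness: \<open>\<parallel>x\<parallel>\<^sup>2 = Re \<langle>x, x\<rangle>\<close>, where \<open>\<langle>x, x\<rangle>\<close> is real by conjugate symmetry.
  The inner product is linear in the first and conjugate-linear in the second argument.
\<close>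

class complex_inner = real_inner +
  fixes scaleC :: "complex \<Rightarrow> 'a \<Rightarrow> 'a" (infixr \<open>*\<^sub>C\<close> 75)
    and cinner :: "'a \<Rightarrow> 'a \<Rightarrow> complex"
  assumes scaleC_add_right: "c *\<^sub>C (x + y) = c *\<^sub>C x + c *\<^sub>C y"
    and scaleC_add_left: "(c + d) *\<^sub>C x = c *\<^sub>C x + d *\<^sub>C x"
    and scaleC_scaleC: "c *\<^sub>C d *\<^sub>C x = (c * d) *\<^sub>C x"
    and scaleC_of_real: "complex_of_real r *\<^sub>C x = r *\<^sub>R x"
    and cinner_commute: "cinner x y = cnj (cinner y x)"
    and cinner_add_left: "cinner (x + y) z = cinner x z + cinner y z"
    and cinner_scaleC_left: "cinner (c *\<^sub>C x) y = c * cinner x y"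
    and Re_cinner: "Re (cinner x y) = x \<bullet> y"

class chilbert_space = complex_inner + complete_space

instantiation complex :: chilbert_space
begin

definition "c *\<^sub>C (x :: complex) = c * x"
definition "cinner x (y :: complex) = x * cnj y"

instance
  by standard
    (auto simp: scaleC_complex_def cinner_complex_def inner_complex_def algebra_simps
      scaleR_conv_of_real)

end

interpretation complex_vector: vector_space "(*\<^sub>C) :: complex \<Rightarrow> 'a \<Rightarrow> 'a::complex_inner"
proof
  show "1 *\<^sub>C x = x" for x :: 'a
    using scaleC_of_real[of 1 x] by simp
qed (simp_all add: scaleC_add_right scaleC_add_left scaleC_scaleC)

text \<open>
  Unbounded operators are represented by their graphs: \<open>(x, y) \<in> T\<close> means that
  \<open>x\<close> lies in the domain of \<open>T\<close> and \<open>T x = y\<close>.  Thus \<^const>\<open>Domain\<close> and \<^const>\<open>Range\<close> are domain and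
  range, \<open>T\<inverse>\<close> is the inverse (of an injective \<open>T\<close>), and \<open>T ^^ n\<close> is the \<open>n\<close>-th power on its
  natural domain.  The definitions below make sense for arbitrary relations;
  \<open>linear_operator\<close> singles out the graphs of linear operators.
\<close>

type_synonym 'a operator = "('a \<times> 'a) set"

definition linear_operator :: "'a::complex_inner operator \<Rightarrow> bool" where
  "linear_operator T \<longleftrightarrow> single_valued T \<and> (0, 0) \<in> T \<and>
     (\<forall>x y x' y'. (x, y) \<in> T \<longrightarrow> (x', y') \<in> T \<longrightarrow> (x + x', y + y') \<in> T) \<and>
     (\<forall>c x y. (x, y) \<in> T \<longrightarrow> (c *\<^sub>C x, c *\<^sub>C y) \<in> T)"

definition densely_defined :: "'a::complex_inner operator \<Rightarrow> bool" where
  "densely_defined T \<longleftrightarrow> closure (Domain T) = UNIV"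

definition closed_operator :: "'a::complex_inner operator \<Rightarrow> bool" where
  "closed_operator T \<longleftrightarrow> linear_operator T \<and> closed T"

definition bounded_operator :: "'a::complex_inner operator \<Rightarrow> bool" where
  "bounded_operator T \<longleftrightarrow> linear_operator T \<and> Domain T = UNIV \<and>
     (\<exists>C. \<forall>x y. (x, y) \<in> T \<longrightarrow> norm y \<le> C * norm x)"

definition compact_operator :: "'a::complex_inner operator \<Rightarrow> bool" where
  "compact_operator T \<longleftrightarrow> bounded_operator T \<and> compact (closure (T `` cball 0 1))"

text \<open>\<open>S \<circ>\<^sub>o T\<close> applies \<open>T\<close> first; its domain is \<open>{x \<in> Domain T. T x \<in> Domain S}\<close>.\<close>

definition op_comp :: "'a operator \<Rightarrow> 'a operator \<Rightarrow> 'a operator" (infixr \<open>\<circ>\<^sub>o\<close> 75) where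
  "S \<circ>\<^sub>o T = T O S"

definition op_shift :: "'a::complex_inner operator \<Rightarrow> complex \<Rightarrow> 'a operator" (infixl \<open>-\<^sub>o\<close> 65) where
  "T -\<^sub>o \<mu> = {(x, y - \<mu> *\<^sub>C x) | x y. (x, y) \<in> T}"

definition op_ker :: "'a::zero operator \<Rightarrow> 'a set" where
  "op_ker T = {x. (x, 0) \<in> T}"

text \<open>This is single-valued, hence the graph of an operator, if \<open>T\<close> is densely defined.\<close>

definition adjoint_op :: "'a::complex_inner operator \<Rightarrow> 'a operator" where
  "adjoint_op T = {(y, z). \<forall>x w. (x, w) \<in> T \<longrightarrow> cinner w y = cinner x z}"

definition symmetric_operator :: "'a::complex_inner operator \<Rightarrow> bool" where
  "symmetric_operator T \<longleftrightarrow> linear_operator T \<and> densely_defined T \<and>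
     (\<forall>x x' y y'. (x, x') \<in> T \<longrightarrow> (y, y') \<in> T \<longrightarrow> cinner x' y = cinner x y')"

definition resolvent_set :: "'a::complex_inner operator \<Rightarrow> complex set" where
  "resolvent_set T = {\<mu>. bounded_operator ((T -\<^sub>o \<mu>)\<inverse>)}"

definition point_spectrum :: "'a::complex_inner operator \<Rightarrow> complex set" where
  "point_spectrum T = {\<mu>. \<exists>x. x \<noteq> 0 \<and> (x, \<mu> *\<^sub>C x) \<in> T}"

definition has_compact_resolvent :: "'a::complex_inner operator \<Rightarrow> bool" where
  "has_compact_resolvent T \<longleftrightarrow> (\<exists>\<mu>\<in>resolvent_set T. compact_operator ((T -\<^sub>o \<mu>)\<inverse>))"

definition generalised_eigenvectors :: "'a::complex_inner operator \<Rightarrow> 'a set" where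
  "generalised_eigenvectors T =
     {x. x \<noteq> 0 \<and> (\<exists>\<mu>\<in>point_spectrum T. \<exists>n\<ge>1. x \<in> op_ker ((T -\<^sub>o \<mu>) ^^ n))}"

definition complete_generalised_eigenvectors :: "'a::complex_inner operator \<Rightarrow> bool" where
  "complete_generalised_eigenvectors T \<longleftrightarrow>
     closure (complex_vector.span (generalised_eigenvectors T)) = UNIV"

end

theory Submission
  imports Defs
begin

text \<open>
  Everything is read off from the subspace
  \[ M = \bigcap_t \ker (B S_t), \qquad S_t = (A^* + it)^{-1} = ((A - it)^{-1})^*, \]
  called \<open>unobservable A B\<close> below.  Since the range of \<open>S\<^sub>t\<close> is \<open>D(A\<^sup>*)\<close>, which lies in \<open>D(B)\<close>, and
  \<open>B\<close> is symmetric with dense domain, \<open>B S\<^sub>t x = 0\<close> means that \<open>S\<^sub>t x\<close> is orthogonal to the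
  range of \<open>B\<^sup>*\<close> (\<open>symmetric_operator_ker_iff\<close>), that is, \<open>x\<close> is orthogonal to all vectors
  \<open>(A - it)\<^sup>-\<^sup>1 B\<^sup>* u\<close>.  So \<open>M\<close> is the orthogonal complement of the span in (iii), and both (ii) and
  (iii) say that \<open>M = {0}\<close>.  If \<open>B\<close> is injective then \<open>M = {0}\<close> because \<open>S\<^sub>t\<close> is injective.  An
  eigenvector \<open>y\<close> of \<open>A\<^sup>*\<close> in \<open>ker B\<close> lies in \<open>M\<close>, because \<open>S\<^sub>t y\<close> is a multiple of \<open>y\<close>; so (iii)
  implies (iv).

  Now assume (iv), compact resolvent and completeness.  The resolvent identity
  \<open>S\<^sub>t x - S\<^sub>0 x = -it S\<^sub>t S\<^sub>0 x\<close>, together with a limit \<open>t \<longlonglongrightarrow> 0\<close>, shows that \<open>S\<^sub>0\<close> maps the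
  closed subspace \<open>M\<close> into itself (\<open>unobservable_invariant\<close>).  If \<open>z \<in> M\<close> satisfies
  \<open>z = \<mu> S\<^sub>0 z\<close>, then \<open>S\<^sub>0 z\<close> lies in \<open>ker B\<close> and in \<open>ker (A\<^sup>* - \<mu>)\<close>, so (iv) forces \<open>z = 0\<close>.
  Hence \<open>1 - \<mu> S\<^sub>0\<close> is injective on \<open>M\<close>.  As \<open>S\<^sub>0\<close> is compact, the Fredholm alternative on \<open>M\<close>
  (\<open>fredholm_surjective\<close>) shows that \<open>1 - \<mu> S\<^sub>0\<close> maps \<open>M\<close> onto \<open>M\<close>.

  This makes \<open>M\<close> orthogonal to every \<open>v\<close> with \<open>(A - \<mu>)\<^sup>n v = 0\<close>
  (\<open>generalised_eigenvector_orthogonal\<close>), by induction on \<open>n\<close>: if \<open>w = (A - \<mu>) v\<close> is orthogonal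
  to \<open>M\<close>, then \<open>(1 - \<mu> A\<^sup>-\<^sup>1) v = A\<^sup>-\<^sup>1 w\<close> gives, for all \<open>z \<in> M\<close>,
  \[ \langle v, (1 - \bar\mu S_0) z\rangle = \langle (1 - \mu A^{-1}) v, z\rangle
     = \langle w, S_0 z\rangle = 0, \]
  and the vectors \<open>(1 - cnj \<mu> S\<^sub>0) z\<close> with \<open>z \<in> M\<close> exhaust \<open>M\<close>.  Completeness of the
  generalised eigenvectors then yields \<open>M = {0}\<close>.
\<close>

section \<open>Orthogonality in real Hilbert spaces\<close>

text \<open>
  A minimising sequence for the distance from \<open>x\<close> to \<open>N\<close> is Cauchy by the parallelogram law; its
  limit \<open>p\<close> is a nearest point, and varying \<open>p\<close> inside \<open>N\<close> shows that \<open>x - p\<close> is orthogonal to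
  \<open>N\<close>.
\<close>

lemma closed_subspace_projection:
  fixes x :: "'a::{real_inner, complete_space}"
  assumes N: "subspace N" "closed N"
  obtains p where "p \<in> N" "\<And>y. y \<in> N \<Longrightarrow> (x - p) \<bullet> y = 0"
proof -
  define d where "d = Inf ((\<lambda>y. (norm (x - y))\<^sup>2) ` N)"
  have ne: "(\<lambda>y. (norm (x - y))\<^sup>2) ` N \<noteq> {}"
    using subspace_0[OF N(1)] by blast
  have bdd: "bdd_below ((\<lambda>y. (norm (x - y))\<^sup>2) ` N)"
    by (rule bdd_belowI[of _ 0]) auto
  have d_le: "d \<le> (norm (x - y))\<^sup>2" if "y \<in> N" for y
    unfolding d_def using bdd that by (intro cInf_lower) auto
  have "\<exists>y\<in>N. (norm (x - y))\<^sup>2 < d + 1 / real (Suc n)" for n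
    using cInf_lessD[OF ne, of "d + 1 / real (Suc n)"] unfolding d_def by auto
  then obtain y where yN: "\<And>n. y n \<in> N"
    and y_less: "\<And>n. (norm (x - y n))\<^sup>2 < d + 1 / real (Suc n)"
    by metis
  have dist_le: "(dist (y m) (y n))\<^sup>2 \<le> 2 / real (Suc m) + 2 / real (Suc n)" for m n
  proof -
    have "(1/2) *\<^sub>R (y m + y n) \<in> N"
      using yN N(1) by (intro subspace_scale subspace_add) auto
    then have "d \<le> (norm (x - (1/2) *\<^sub>R (y m + y n)))\<^sup>2"
      by (rule d_le)
    moreover have "(norm (y m - y n))\<^sup>2 = 2 * (norm (x - y m))\<^sup>2 + 2 * (norm (x - y n))\<^sup>2
        - 4 * (norm (x - (1/2) *\<^sub>R (y m + y n)))\<^sup>2"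
      by (simp add: power2_norm_eq_inner inner_diff inner_add inner_commute field_simps)
    ultimately show ?thesis
      using y_less[of m] y_less[of n] by (simp add: dist_norm)
  qed
  have "Cauchy y"
  proof (rule metric_CauchyI)
    fix e :: real assume e: "e > 0"
    obtain k where k: "inverse (real (Suc k)) < e\<^sup>2 / 4"
      using reals_Archimedean[of "e\<^sup>2 / 4"] e by auto
    have "dist (y m) (y n) < e" if "m \<ge> k" "n \<ge> k" for m n
    proof -
      have "1 / real (Suc m) \<le> inverse (real (Suc k))" "1 / real (Suc n) \<le> inverse (real (Suc k))"
        using that by (auto simp: field_simps)
      then have "(dist (y m) (y n))\<^sup>2 < e\<^sup>2"
        using dist_le[of m n] k by simp
      then show ?thesis
        using e by (simp add: power2_less_imp_less)
    qed
    then show "\<exists>M. \<forall>m\<ge>M. \<forall>n\<ge>M. dist (y m) (y n) < e" by blast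
  qed
  then obtain p where p: "y \<longlonglongrightarrow> p"
    using Cauchy_convergent convergent_def by blast
  have pN: "p \<in> N"
    using closed_sequentially[OF N(2) _ p] yN by blast
  have "(norm (x - p))\<^sup>2 \<le> d + 0"
  proof (rule LIMSEQ_le)
    show "(\<lambda>n. (norm (x - y n))\<^sup>2) \<longlonglongrightarrow> (norm (x - p))\<^sup>2"
      by (intro tendsto_intros p)
    show "(\<lambda>n. d + 1 / real (Suc n)) \<longlonglongrightarrow> d + 0"
      using LIMSEQ_inverse_real_of_nat by (intro tendsto_intros) (simp add: inverse_eq_divide)
    show "\<exists>k. \<forall>n\<ge>k. (norm (x - y n))\<^sup>2 \<le> d + 1 / real (Suc n)"
      using y_less less_imp_le by blast
  qed
  then have p_min: "(norm (x - p))\<^sup>2 \<le> (norm (x - z))\<^sup>2" if "z \<in> N" for z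
    using d_le[OF that] by linarith
  have "(x - p) \<bullet> z = 0" if z: "z \<in> N" for z
  proof (cases "z = 0")
    case False
    \<comment> \<open>This \<open>s\<close> makes \<open>p + s z\<close> the point nearest to \<open>x\<close> on the line through \<open>p\<close> along \<open>z\<close>.\<close>
    define s where "s = ((x - p) \<bullet> z) / (z \<bullet> z)"
    have "p + s *\<^sub>R z \<in> N"
      using pN z N(1) by (intro subspace_add subspace_scale) auto
    from p_min[OF this] have "2 * s * ((x - p) \<bullet> z) \<le> s * s * (z \<bullet> z)"
      by (simp add: power2_norm_eq_inner inner_diff inner_add inner_commute algebra_simps)
    also have "s * s * (z \<bullet> z) = s * ((x - p) \<bullet> z)"
      using False by (simp add: s_def)
    finally have "s * ((x - p) \<bullet> z) \<le> 0" by simp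
    moreover have "s * ((x - p) \<bullet> z) = ((x - p) \<bullet> z)\<^sup>2 / (z \<bullet> z)"
      by (simp add: s_def power2_eq_square)
    ultimately have "((x - p) \<bullet> z)\<^sup>2 / (z \<bullet> z) \<le> 0" by simp
    moreover have "z \<bullet> z > 0" using False by simp
    ultimately have "((x - p) \<bullet> z)\<^sup>2 \<le> 0"
      by (simp add: divide_le_0_iff)
    then show ?thesis by simp
  qed simp
  with pN show thesis by (rule that)
qed

text \<open>
  The Riesz representation of the functional \<open>\<lambda>x. f x \<bullet> y\<close> is found as usual: a vector \<open>q\<close>
  orthogonal to its kernel represents it up to a factor.
\<close>

lemma bounded_linear_adjoint:
  fixes f :: "'a::{real_inner, complete_space} \<Rightarrow> 'b::real_inner"
  assumes f: "bounded_linear f"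
  obtains g where "bounded_linear g" "\<And>x y. f x \<bullet> y = x \<bullet> g y"
proof -
  interpret f: bounded_linear f by (rule f)
  have "\<exists>z. \<forall>x. f x \<bullet> y = x \<bullet> z" for y
  proof (cases "\<forall>x. f x \<bullet> y = 0")
    case True
    then show ?thesis by (intro exI[of _ 0]) simp
  next
    case False
    then obtain a where a: "f a \<bullet> y \<noteq> 0" by blast
    define N where "N = {x. f x \<bullet> y = 0}"
    have "subspace N"
      by (auto simp: N_def subspace_def f.add f.scaleR f.zero inner_add_left)
    moreover have "closed N"
      unfolding N_def
      by (intro closed_Collect_eq continuous_intros f.continuous_on)
    ultimately obtain p where p: "p \<in> N" "\<And>z. z \<in> N \<Longrightarrow> (a - p) \<bullet> z = 0"
      using closed_subspace_projection by metis
    define q where "q = a - p"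
    have fq: "f q \<bullet> y \<noteq> 0"
      using a p(1) by (simp add: q_def N_def f.diff inner_diff_left)
    then have qq: "q \<bullet> q \<noteq> 0" by (auto simp: f.zero)
    have "f x \<bullet> y = x \<bullet> (((f q \<bullet> y) / (q \<bullet> q)) *\<^sub>R q)" for x
    proof -
      have "x - ((f x \<bullet> y) / (f q \<bullet> y)) *\<^sub>R q \<in> N"
        using fq by (simp add: N_def f.diff f.scaleR inner_diff_left)
      then have "q \<bullet> (x - ((f x \<bullet> y) / (f q \<bullet> y)) *\<^sub>R q) = 0"
        using p(2) by (simp add: q_def)
      then show ?thesis
        using fq qq by (simp add: inner_diff_right inner_commute field_simps)
    qed
    then show ?thesis by blast
  qed
  then obtain g where g: "\<And>x y. f x \<bullet> y = x \<bullet> g y" by metis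
  obtain C where C: "\<And>x. norm (f x) \<le> norm x * C" "C > 0"
    using f.pos_bounded by blast
  have "bounded_linear g"
  proof (rule bounded_linear_intro[where K = C])
    show "g (x + y) = g x + g y" for x y
      by (subst vector_eq_rdot[symmetric]) (simp add: inner_commute inner_add_right flip: g)
    show "g (r *\<^sub>R x) = r *\<^sub>R g x" for r x
      by (subst vector_eq_rdot[symmetric]) (simp add: inner_commute flip: g)
    show "norm (g y) \<le> norm y * C" for y
    proof (cases "g y = 0")
      case False
      have "norm (g y) * norm (g y) = f (g y) \<bullet> y"
        by (simp add: g flip: power2_norm_eq_inner power2_eq_square)
      also have "\<dots> \<le> norm (f (g y)) * norm y"
        by (rule norm_cauchy_schwarz)
      also have "\<dots> \<le> norm (g y) * C * norm y"
        by (intro mult_right_mono C) simp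
      finally show ?thesis using False by (simp add: mult_ac)
    qed (use C(2) in simp)
  qed
  with g show thesis using that by blast
qed

section \<open>Compact maps and the Fredholm alternative\<close>

text \<open>
  Compactness by sequences is convenient here, since it passes to compositions and to adjoints by
  taking subsequences.
\<close>

definition compact_map :: "('a::real_normed_vector \<Rightarrow> 'b::real_normed_vector) \<Rightarrow> bool" where
  "compact_map f \<longleftrightarrow>
     (\<forall>x :: nat \<Rightarrow> 'a. bounded (range x) \<longrightarrow> (\<exists>r. strict_mono (r :: nat \<Rightarrow> nat) \<and> convergent (\<lambda>n. f (x (r n)))))"

lemma compact_mapE:
  assumes "compact_map f" "\<And>n. norm (x n) \<le> C"
  obtains r l where "strict_mono (r :: nat \<Rightarrow> nat)" "(\<lambda>n. f (x (r n))) \<longlonglongrightarrow> l"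
proof -
  have "bounded (range x)" using assms(2) by (auto simp: bounded_iff)
  with assms(1) that show thesis unfolding compact_map_def convergent_def by blast
qed

lemma compact_map_comp:
  fixes f :: "'b::real_normed_vector \<Rightarrow> 'c::real_normed_vector"
    and g :: "'a::real_normed_vector \<Rightarrow> 'b"
  assumes f: "compact_map f" and g: "bounded_linear g"
  shows "compact_map (\<lambda>x. f (g x))"
  unfolding compact_map_def
proof (intro allI impI)
  fix x :: "nat \<Rightarrow> 'a" assume "bounded (range x)"
  then have "bounded (g ` range x)" by (rule bounded_linear_image[OF _ g])
  then have "bounded (range (\<lambda>n. g (x n)))" by (simp add: image_image)
  then show "\<exists>r. strict_mono r \<and> convergent (\<lambda>n. f (g (x (r n))))"
    using f unfolding compact_map_def by auto
qed

text \<open>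
  Schauder's theorem is elementary in Hilbert spaces: \<open>f \<circ> g\<close> is compact, and
  \<open>\<parallel>g z\<parallel>\<^sup>2 = \<langle>f (g z), z\<rangle> \<le> \<parallel>f (g z)\<parallel> \<parallel>z\<parallel>\<close> transfers the Cauchy property along a bounded
  sequence from \<open>f \<circ> g\<close> to \<open>g\<close>.
\<close>

lemma compact_map_adjoint:
  fixes f :: "'a::{real_inner, complete_space} \<Rightarrow> 'b::{real_inner, complete_space}"
  assumes f: "compact_map f" and g: "bounded_linear g" and adj: "\<And>x y. f x \<bullet> y = x \<bullet> g y"
  shows "compact_map g"
  unfolding compact_map_def
proof (intro allI impI)
  interpret g: bounded_linear g by (rule g)
  fix x :: "nat \<Rightarrow> 'b" assume bx: "bounded (range x)"
  obtain r l where r: "strict_mono (r :: nat \<Rightarrow> nat)" and l: "(\<lambda>n. f (g (x (r n)))) \<longlonglongrightarrow> l"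
    using compact_map_comp[OF f g] bx unfolding compact_map_def convergent_def by blast
  obtain C where C: "\<And>n. norm (x n) \<le> C" "C > 0"
    using bx unfolding bounded_pos by auto
  have "Cauchy (\<lambda>n. g (x (r n)))"
  proof (rule metric_CauchyI)
    fix e :: real assume e: "e > 0"
    have "Cauchy (\<lambda>n. f (g (x (r n))))"
      using l by (rule LIMSEQ_imp_Cauchy)
    from metric_CauchyD[OF this, of "e\<^sup>2 / (2 * C)"] obtain k where
      k: "\<And>m n. m \<ge> k \<Longrightarrow> n \<ge> k \<Longrightarrow> dist (f (g (x (r m)))) (f (g (x (r n)))) < e\<^sup>2 / (2 * C)"
      using e C(2) by auto
    have "dist (g (x (r m))) (g (x (r n))) < e" if mn: "m \<ge> k" "n \<ge> k" for m n
    proof -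
      let ?z = "x (r m) - x (r n)"
      have fz: "f (g (x (r m)) - g (x (r n))) \<bullet> y
          = (f (g (x (r m))) - f (g (x (r n)))) \<bullet> y" for y
        by (simp add: adj inner_diff_left)
      have "(norm (g ?z))\<^sup>2 = f (g ?z) \<bullet> ?z"
        by (simp only: adj power2_norm_eq_inner)
      also have "\<dots> = (f (g (x (r m))) - f (g (x (r n)))) \<bullet> ?z"
        by (simp only: g.diff fz)
      also have "\<dots> \<le> norm (f (g (x (r m))) - f (g (x (r n)))) * norm ?z"
        by (rule norm_cauchy_schwarz)
      also have "\<dots> \<le> norm (f (g (x (r m))) - f (g (x (r n)))) * (2 * C)"
        using norm_triangle_ineq4[of "x (r m)" "x (r n)"] C(1)[of "r m"] C(1)[of "r n"]
        by (intro mult_left_mono) auto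
      also have "\<dots> < e\<^sup>2"
        using k[OF mn] C(2) by (simp add: dist_norm field_simps)
      finally have "norm (g ?z) < e"
        using e by (simp add: power2_less_imp_less)
      then show ?thesis by (simp add: dist_norm g.diff)
    qed
    then show "\<exists>k. \<forall>m\<ge>k. \<forall>n\<ge>k. dist (g (x (r m))) (g (x (r n))) < e" by blast
  qed
  with r show "\<exists>r. strict_mono r \<and> convergent (\<lambda>n. g (x (r n)))"
    using Cauchy_convergent by blast
qed

text \<open>
  Unit vectors \<open>e\<^sub>n\<close> with \<open>e\<^sub>n - K e\<^sub>n \<longlonglongrightarrow> 0\<close> would, along a subsequence on which \<open>K e\<^sub>n\<close>
  converges, converge to a unit vector fixed by \<open>K\<close>.  The lower bound makes \<open>1 - K\<close> map closed
  subspaces of \<open>M\<close> to closed subspaces when the space is complete.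
\<close>

lemma fredholm_bounded_below:
  fixes K :: "'a::real_normed_vector \<Rightarrow> 'a"
  assumes K: "bounded_linear K" "compact_map K"
    and M: "subspace M" "closed M"
    and inj: "\<And>x. x \<in> M \<Longrightarrow> K x = x \<Longrightarrow> x = 0"
  obtains c where "c > 0" "\<And>x. x \<in> M \<Longrightarrow> norm (x - K x) \<ge> c * norm x"
proof -
  interpret K: bounded_linear K by (rule K(1))
  have "\<exists>c>0. \<forall>x\<in>M. norm (x - K x) \<ge> c * norm x"
  proof (rule ccontr)
    assume "\<not> ?thesis"
    then have "\<exists>x\<in>M. norm (x - K x) < (1 / real (Suc n)) * norm x" for n
      by (metis less_divide_eq_1_pos of_nat_0_less_iff zero_less_Suc zero_less_divide_1_iff not_less)
    then obtain x where x: "\<And>n. x n \<in> M"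
      "\<And>n. norm (x n - K (x n)) < (1 / real (Suc n)) * norm (x n)"
      by metis
    have x0: "x n \<noteq> 0" for n using x(2)[of n] by auto
    define e where "e n = x n /\<^sub>R norm (x n)" for n
    have eM: "e n \<in> M" for n
      unfolding e_def using x(1) M(1) by (intro subspace_scale)
    have e1: "norm (e n) = 1" for n using x0 by (simp add: e_def)
    have e_small: "norm (e n - K (e n)) \<le> 1 / real (Suc n)" for n
    proof -
      have "e n - K (e n) = (x n - K (x n)) /\<^sub>R norm (x n)"
        by (simp add: e_def K.scaleR scaleR_diff_right)
      then have "norm (e n - K (e n)) = norm (x n - K (x n)) / norm (x n)"
        by (simp add: divide_inverse)
      also have "\<dots> \<le> 1 / real (Suc n)"
        using x(2)[of n] x0[of n] by (simp add: divide_le_eq)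
      finally show ?thesis .
    qed
    have lim0: "(\<lambda>n. e n - K (e n)) \<longlonglongrightarrow> 0"
    proof (rule Lim_null_comparison)
      show "\<forall>\<^sub>F n in sequentially. norm (e n - K (e n)) \<le> 1 / real (Suc n)"
        using e_small by simp
      show "(\<lambda>n. 1 / real (Suc n)) \<longlonglongrightarrow> 0"
        using LIMSEQ_inverse_real_of_nat by (simp add: inverse_eq_divide)
    qed
    obtain r l where r: "strict_mono (r :: nat \<Rightarrow> nat)" and l: "(\<lambda>n. K (e (r n))) \<longlonglongrightarrow> l"
      using compact_mapE[OF K(2), of e 1] e1 by auto
    have "(\<lambda>n. (e (r n) - K (e (r n))) + K (e (r n))) \<longlonglongrightarrow> 0 + l"
      using LIMSEQ_subseq_LIMSEQ[OF lim0 r] l by (intro tendsto_add) (auto simp: o_def)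
    then have el: "(\<lambda>n. e (r n)) \<longlonglongrightarrow> l" by simp
    then have "(\<lambda>n. K (e (r n))) \<longlonglongrightarrow> K l" by (rule K.tendsto)
    with l have "K l = l" by (rule LIMSEQ_unique[symmetric])
    moreover have "l \<in> M" using closed_sequentially[OF M(2) _ el] eM by blast
    moreover have "norm l = 1"
      using tendsto_norm[OF el] e1 by (simp add: LIMSEQ_const_iff)
    ultimately show False using inj by fastforce
  qed
  then show thesis using that by blast
qed

text \<open>
  Let \<open>f = 1 - K\<close> on \<open>M\<close>.  If the injective map \<open>f\<close> were not onto, the ranges \<open>R\<^sub>n = f\<^sup>n M\<close> would
  form a strictly decreasing chain of closed subspaces.  Unit vectors \<open>e\<^sub>n \<in> R\<^sub>n\<close> orthogonal to
  \<open>R\<^sub>n\<^sub>+\<^sub>1\<close> would then satisfy \<open>\<parallel>K e\<^sub>m - K e\<^sub>n\<parallel> \<ge> 1\<close> for \<open>m < n\<close>, because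
  \<open>K e\<^sub>m - K e\<^sub>n\<close> differs from \<open>e\<^sub>m\<close> by an element of \<open>R\<^sub>m\<^sub>+\<^sub>1\<close>; this contradicts compactness.
\<close>

lemma fredholm_surjective:
  fixes K :: "'a::{real_inner, complete_space} \<Rightarrow> 'a"
  assumes K: "bounded_linear K" "compact_map K"
    and M: "subspace M" "closed M" "K ` M \<subseteq> M"
    and inj: "\<And>x. x \<in> M \<Longrightarrow> K x = x \<Longrightarrow> x = 0"
    and y: "y \<in> M"
  obtains x where "x \<in> M" "x - K x = y"
proof -
  interpret K: bounded_linear K by (rule K(1))
  obtain c where c: "c > 0" "\<And>x. x \<in> M \<Longrightarrow> norm (x - K x) \<ge> c * norm x"
    using fredholm_bounded_below[OF K M(1,2) inj] by metis
  define f where "f x = x - K x" for x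
  have blf: "bounded_linear f"
    unfolding f_def by (intro bounded_linear_sub bounded_linear_ident K(1))
  interpret f: bounded_linear f by (rule blf)
  have fM: "f x \<in> M" if "x \<in> M" for x
    using that M unfolding f_def by (auto intro: subspace_diff)
  define R where "R n = (f ^^ n) ` M" for n
  have R_Suc: "R (Suc n) = f ` R n" for n by (simp add: R_def image_comp)
  have R_props: "subspace (R n) \<and> complete (R n) \<and> R n \<subseteq> M \<and> R (Suc n) \<subseteq> R n" for n
  proof (induction n)
    case 0
    show ?case using M fM by (auto simp: R_def complete_eq_closed)
  next
    case (Suc n)
    then have n: "subspace (R n)" "complete (R n)" "R n \<subseteq> M" "R (Suc n) \<subseteq> R n" by auto
    have "subspace (R (Suc n))"
      unfolding R_Suc using f.linear_axioms n(1) by (rule linear_subspace_image)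
    moreover have "complete (R (Suc n))"
      unfolding R_Suc
      using c(1) n(1) blf _ n(2)
    proof (rule complete_isometric_image)
      show "\<forall>x\<in>R n. norm (f x) \<ge> c * norm x"
        using c(2) n(3) by (auto simp: f_def)
    qed
    moreover have "R (Suc (Suc n)) \<subseteq> R (Suc n)"
      using n(4) by (simp only: R_Suc[of "Suc n"] R_Suc[of n]) blast
    ultimately show ?case using n by blast
  qed
  have mono: "R n \<subseteq> R m" if "m \<le> n" for m n
    using that by (rule lift_Suc_antimono_le[rotated]) (use R_props in blast)
  have finj: "inj_on f M"
  proof (rule inj_onI)
    fix a b assume ab: "a \<in> M" "b \<in> M" "f a = f b"
    then have "K (a - b) = a - b" by (simp add: f_def K.diff algebra_simps)
    moreover have "a - b \<in> M" using ab M(1) by (intro subspace_diff)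
    ultimately have "a - b = 0" by (intro inj)
    then show "a = b" by simp
  qed
  have "y \<in> R 1"
  proof (rule ccontr)
    assume yR: "y \<notin> R 1"
    have fn: "(f ^^ n) y \<in> R n - R (Suc n)" for n
    proof (induction n)
      case 0
      show ?case using y yR by (simp add: R_def)
    next
      case (Suc n)
      have "f ((f ^^ n) y) \<notin> f ` R (Suc n)"
        using Suc finj R_props[of n] R_props[of "Suc n"]
        by (metis DiffE inj_on_image_mem_iff subset_eq)
      then show ?case using Suc by (simp add: R_Suc)
    qed
    have "\<exists>e. e \<in> R n \<and> norm e = 1 \<and> (\<forall>z\<in>R (Suc n). e \<bullet> z = 0)" for n
    proof -
      have cl: "closed (R (Suc n))" using R_props by (simp add: complete_eq_closed)
      obtain p where p: "p \<in> R (Suc n)" "\<And>z. z \<in> R (Suc n) \<Longrightarrow> ((f ^^ n) y - p) \<bullet> z = 0"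
        using closed_subspace_projection[OF _ cl] R_props by blast
      define q where "q = (f ^^ n) y - p"
      have "q \<in> R n" unfolding q_def using fn p(1) R_props by (blast intro: subspace_diff)
      moreover have "q \<noteq> 0" using fn[of n] p(1) by (auto simp: q_def)
      ultimately show ?thesis
        using p(2) R_props by (intro exI[of _ "q /\<^sub>R norm q"]) (auto simp: q_def subspace_scale)
    qed
    then obtain e where e: "\<And>n. e n \<in> R n" "\<And>n. norm (e n) = 1"
      "\<And>n z. z \<in> R (Suc n) \<Longrightarrow> e n \<bullet> z = 0" by metis
    have sep: "norm (K (e m) - K (e n)) \<ge> 1" if "m < n" for m n
    proof -
      define z where "z = f (e m) + (e n - f (e n))"
      have "e n \<in> R (Suc m)" "f (e n) \<in> R (Suc m)" "f (e m) \<in> R (Suc m)"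
        using e(1)[of n] e(1)[of m] mono[of "Suc m" n] R_props[of n] that by (auto simp: R_Suc)
      then have "z \<in> R (Suc m)"
        unfolding z_def using R_props by (intro subspace_add subspace_diff) auto
      then have "e m \<bullet> (e m - z) = 1"
        using e(3) e(2)[of m] by (simp add: inner_diff_right flip: power2_norm_eq_inner)
      then have "1 \<le> norm (e m) * norm (e m - z)"
        using norm_cauchy_schwarz[of "e m" "e m - z"] by simp
      also have "e m - z = K (e m) - K (e n)" by (simp add: z_def f_def)
      finally show ?thesis using e(2) by simp
    qed
    obtain r l where r: "strict_mono (r :: nat \<Rightarrow> nat)" and l: "(\<lambda>n. K (e (r n))) \<longlonglongrightarrow> l"
      using compact_mapE[OF K(2), of e 1] e(2) by auto
    obtain k where k: "\<And>m n. m \<ge> k \<Longrightarrow> n \<ge> k \<Longrightarrow> dist (K (e (r m))) (K (e (r n))) < 1"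
      using metric_CauchyD[OF LIMSEQ_imp_Cauchy[OF l], of 1] by auto
    have "r k < r (Suc k)" using r by (simp add: strict_monoD)
    from sep[OF this] k[of k "Suc k"] show False by (simp add: dist_norm)
  qed
  then show thesis using that by (auto simp: R_def f_def)
qed

section \<open>Complex inner products and dense spans\<close>

lemma cinner_add_right: "cinner x (y + z) = cinner x y + cinner x z"
  by (metis cinner_commute cinner_add_left complex_cnj_add)

lemma cinner_scaleC_right: "cinner x (c *\<^sub>C y) = cnj c * cinner x y"
  by (metis cinner_commute cinner_scaleC_left complex_cnj_mult)

lemma scaleC_minus_one: "(-1) *\<^sub>C (x :: 'a::complex_inner) = - x"
  using scaleC_of_real[of "-1" x] by simp

lemma cinner_minus_left: "cinner (- x) y = - cinner x y"
  using cinner_scaleC_left[of "-1" x y] by (simp add: scaleC_minus_one)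

lemma cinner_minus_right: "cinner x (- y) = - cinner x y"
  using cinner_scaleC_right[of x "-1" y] by (simp add: scaleC_minus_one)

lemma cinner_diff_left: "cinner (x - y) z = cinner x z - cinner y z"
  using cinner_add_left[of x "- y" z] by (simp add: cinner_minus_left)

lemma cinner_diff_right: "cinner x (y - z) = cinner x y - cinner x z"
  using cinner_add_right[of x y "- z"] by (simp add: cinner_minus_right)

lemma cinner_zero_left [simp]: "cinner 0 x = 0"
  using cinner_diff_left[of x x x] by simp

lemma cinner_zero_right [simp]: "cinner x 0 = 0"
  using cinner_diff_right[of x x x] by simp

lemma cinner_eq_0_commute: "cinner x y = 0 \<longleftrightarrow> cinner y x = 0"
  by (subst cinner_commute) simp

text \<open>
  The imaginary part of the complex inner product is determined by the real one, so that real
  orthogonality to a complex subspace is complex orthogonality.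
\<close>

lemma cinner_conv_inner: "cinner x y = Complex (x \<bullet> y) (- ((\<i> *\<^sub>C x) \<bullet> y))"
  by (simp add: complex_eq_iff cinner_scaleC_left flip: Re_cinner)

lemma norm_scaleC: "norm (c *\<^sub>C x) = cmod c * norm (x :: 'a::complex_inner)"
proof -
  have "(norm (c *\<^sub>C x))\<^sup>2 = (cmod c * norm x)\<^sup>2"
  proof -
    have "cinner (c *\<^sub>C x) (c *\<^sub>C x) = (c * cnj c) * cinner x x"
      by (simp add: cinner_scaleC_left cinner_scaleC_right)
    also have "c * cnj c = complex_of_real ((cmod c)\<^sup>2)"
      by (rule complex_norm_square[symmetric])
    finally show ?thesis
      by (simp add: power2_norm_eq_inner power_mult_distrib flip: Re_cinner)
  qed
  then show ?thesis by (simp add: power2_eq_iff_nonneg)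
qed

lemma bounded_linear_scaleC: "bounded_linear (\<lambda>x :: 'a::complex_inner. c *\<^sub>C x)"
  by (rule bounded_linear_intro[where K = "cmod c"])
    (simp_all add: scaleC_add_right scaleC_scaleC norm_scaleC mult.commute flip: scaleC_of_real)

lemma bounded_linear_cinner_left: "bounded_linear (\<lambda>x. cinner x y)"
proof (rule bounded_linear_intro[where K = "2 * norm y"])
  show "cinner (r *\<^sub>R x) y = r *\<^sub>R cinner x y" for r x
    by (simp add: cinner_scaleC_left scaleR_conv_of_real flip: scaleC_of_real)
  show "norm (cinner x y) \<le> norm x * (2 * norm y)" for x
    using cmod_le[of "cinner x y"] Cauchy_Schwarz_ineq2[of x y]
      Cauchy_Schwarz_ineq2[of "\<i> *\<^sub>C x" y]
    by (simp add: cinner_conv_inner norm_scaleC)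
qed (rule cinner_add_left)

lemma cinner_eq_zeroI_dense:
  assumes D: "closure D = UNIV" and orth: "\<And>w. w \<in> D \<Longrightarrow> cinner w x = 0"
  shows "x = 0"
proof -
  have "closed {w. cinner w x = 0}"
    by (intro closed_Collect_eq continuous_intros
        linear_continuous_on bounded_linear_cinner_left)
  with orth have "closure D \<subseteq> {w. cinner w x = 0}"
    by (intro closure_minimal) auto
  with D have "cinner x x = 0" by auto
  then have "x \<bullet> x = 0" by (simp flip: Re_cinner)
  then show ?thesis by simp
qed

lemma orthogonal_span:
  assumes "\<And>w. w \<in> X \<Longrightarrow> cinner w x = 0" and "w \<in> complex_vector.span X"
  shows "cinner w x = 0"
  using assms(2)
proof (induction rule: complex_vector.span_induct)
  case base
  show ?case
    by (auto simp: complex_vector.subspace_def cinner_add_left cinner_scaleC_left)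
qed (use assms(1) in auto)

lemma subspace_closure:
  fixes W :: "'a::real_normed_vector set"
  assumes W: "subspace W"
  shows "subspace (closure W)"
proof (rule subspaceI)
  show "0 \<in> closure W" using subspace_0[OF W] closure_subset by blast
  show "x + y \<in> closure W" if xy: "x \<in> closure W" "y \<in> closure W" for x y
  proof -
    obtain f g where "\<forall>n. f n \<in> W" "f \<longlonglongrightarrow> x" "\<forall>n. g n \<in> W" "g \<longlonglongrightarrow> y"
      using xy unfolding closure_sequential by blast
    then show ?thesis
      unfolding closure_sequential
      by (intro exI[of _ "\<lambda>n. f n + g n"] conjI tendsto_add) (auto intro: subspace_add[OF W])
  qed
  show "c *\<^sub>R x \<in> closure W" if x: "x \<in> closure W" for c x
  proof -
    obtain f where "\<forall>n. f n \<in> W" "f \<longlonglongrightarrow> x"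
      using x unfolding closure_sequential by blast
    then show ?thesis
      unfolding closure_sequential
      by (intro exI[of _ "\<lambda>n. c *\<^sub>R f n"] conjI tendsto_scaleR tendsto_const)
        (auto intro: subspace_scale[OF W])
  qed
qed

text \<open>
  For the nontrivial direction, the residual of the projection of any vector to the closed span
  is orthogonal to \<open>X\<close>, so it vanishes.
\<close>

lemma dense_span_iff:
  fixes X :: "'a::chilbert_space set"
  shows "closure (complex_vector.span X) = UNIV \<longleftrightarrow> (\<forall>x. (\<forall>w\<in>X. cinner w x = 0) \<longrightarrow> x = 0)"
proof
  assume "closure (complex_vector.span X) = UNIV"
  then show "\<forall>x. (\<forall>w\<in>X. cinner w x = 0) \<longrightarrow> x = 0"
    using cinner_eq_zeroI_dense orthogonal_span by metis
next
  assume orth: "\<forall>x. (\<forall>w\<in>X. cinner w x = 0) \<longrightarrow> x = 0"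
  let ?W = "complex_vector.span X"
  have "subspace ?W"
    by (intro subspaceI complex_vector.span_zero complex_vector.span_add)
      (auto simp flip: scaleC_of_real intro: complex_vector.span_scale)
  then have sub: "subspace (closure ?W)" by (rule subspace_closure)
  have "x \<in> closure ?W" for x
  proof -
    obtain p where p: "p \<in> closure ?W" "\<And>y. y \<in> closure ?W \<Longrightarrow> (x - p) \<bullet> y = 0"
      using closed_subspace_projection[OF sub closed_closure] by metis
    have "cinner w (x - p) = 0" if "w \<in> X" for w
    proof -
      have "w \<in> ?W" "\<i> *\<^sub>C w \<in> ?W"
        using that by (auto intro: complex_vector.span_base complex_vector.span_scale)
      then have "w \<in> closure ?W" "\<i> *\<^sub>C w \<in> closure ?W"
        using closure_subset by blast+
      then show ?thesis
        using p(2) by (simp add: cinner_conv_inner inner_commute complex_eq_iff)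
    qed
    with orth have "x - p = 0" by blast
    with p(1) show ?thesis by simp
  qed
  then show "closure ?W = UNIV" by blast
qed

section \<open>Resolvents and adjoints\<close>

lemma mem_op_shift_iff: "(x, y) \<in> T -\<^sub>o \<mu> \<longleftrightarrow> (x, y + \<mu> *\<^sub>C x) \<in> T"
  by (auto simp: op_shift_def) (metis add_diff_cancel)

text \<open>
  Graphs are convenient for unbounded operators, but a resolvent is everywhere defined and
  bounded; this is \<open>(T - \<mu>)\<^sup>-\<^sup>1\<close> as a function.  It is meaningful for \<open>\<mu>\<close> in the resolvent set.
\<close>

definition resolvent :: "'a::complex_inner operator \<Rightarrow> complex \<Rightarrow> 'a \<Rightarrow> 'a" where
  "resolvent T \<mu> y = (THE x. (x, y) \<in> T -\<^sub>o \<mu>)"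

lemma linear_operatorD:
  assumes "linear_operator T"
  shows "(x, y) \<in> T \<Longrightarrow> (x, y') \<in> T \<Longrightarrow> y = y'"
    and "(0, 0) \<in> T"
    and "(x, y) \<in> T \<Longrightarrow> (x', y') \<in> T \<Longrightarrow> (x + x', y + y') \<in> T"
    and "(x, y) \<in> T \<Longrightarrow> (c *\<^sub>C x, c *\<^sub>C y) \<in> T"
  using assms unfolding linear_operator_def single_valued_def by blast+

lemma linear_operator_diff:
  assumes "linear_operator T" "(x, y) \<in> T" "(x', y') \<in> T"
  shows "(x - x', y - y') \<in> T"
  using linear_operatorD(3)[OF assms(1,2) linear_operatorD(4)[OF assms(1,3), of "-1"]]
  by (simp add: scaleC_minus_one)

lemma resolvent_iff:
  assumes "\<mu> \<in> resolvent_set T"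
  shows "(x, y) \<in> T -\<^sub>o \<mu> \<longleftrightarrow> x = resolvent T \<mu> y"
proof -
  from assms have lin: "linear_operator ((T -\<^sub>o \<mu>)\<inverse>)" and "Domain ((T -\<^sub>o \<mu>)\<inverse>) = UNIV"
    by (auto simp: resolvent_set_def bounded_operator_def)
  then have "\<exists>!x. (x, y) \<in> T -\<^sub>o \<mu>"
    using linear_operatorD(1)[OF lin] by blast
  then show ?thesis
    unfolding resolvent_def by (metis (mono_tags, lifting) theI)
qed

lemma resolvent_mem:
  "\<mu> \<in> resolvent_set T \<Longrightarrow> (resolvent T \<mu> y, y + \<mu> *\<^sub>C resolvent T \<mu> y) \<in> T"
  using resolvent_iff mem_op_shift_iff by metis

lemma resolventI:
  "\<mu> \<in> resolvent_set T \<Longrightarrow> (x, y + \<mu> *\<^sub>C x) \<in> T \<Longrightarrow> x = resolvent T \<mu> y"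
  using resolvent_iff mem_op_shift_iff by metis

lemma resolvent_scaleC:
  assumes "\<mu> \<in> resolvent_set T"
  shows "resolvent T \<mu> (c *\<^sub>C y) = c *\<^sub>C resolvent T \<mu> y"
proof -
  from assms have "linear_operator ((T -\<^sub>o \<mu>)\<inverse>)"
    by (simp add: resolvent_set_def bounded_operator_def)
  from linear_operatorD(4)[OF this] show ?thesis
    using resolvent_iff[OF assms] by (metis converse_iff)
qed

lemma bounded_linear_resolvent:
  assumes "\<mu> \<in> resolvent_set T"
  shows "bounded_linear (resolvent T \<mu>)"
proof -
  from assms obtain C where lin: "linear_operator ((T -\<^sub>o \<mu>)\<inverse>)"
    and C: "\<And>x y. (x, y) \<in> (T -\<^sub>o \<mu>)\<inverse> \<Longrightarrow> norm y \<le> C * norm x"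
    unfolding resolvent_set_def bounded_operator_def by blast
  show ?thesis
  proof (rule bounded_linear_intro[where K = C])
    show "resolvent T \<mu> (x + y) = resolvent T \<mu> x + resolvent T \<mu> y" for x y
      using linear_operatorD(3)[OF lin] resolvent_iff[OF assms] by (metis converse_iff)
    show "resolvent T \<mu> (r *\<^sub>R x) = r *\<^sub>R resolvent T \<mu> x" for r x
      using resolvent_scaleC[OF assms, of "complex_of_real r" x] by (simp add: scaleC_of_real)
    show "norm (resolvent T \<mu> x) \<le> norm x * C" for x
      using C[of x "resolvent T \<mu> x"] resolvent_iff[OF assms] by (simp add: mult.commute)
  qed
qed

lemma resolvent_identity:
  assumes T: "linear_operator T" and \<mu>: "\<mu> \<in> resolvent_set T" and \<nu>: "\<nu> \<in> resolvent_set T"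
  shows "resolvent T \<mu> x - resolvent T \<nu> x = (\<mu> - \<nu>) *\<^sub>C resolvent T \<mu> (resolvent T \<nu> x)"
proof -
  have "(resolvent T \<mu> x - resolvent T \<nu> x,
      (x + \<mu> *\<^sub>C resolvent T \<mu> x) - (x + \<nu> *\<^sub>C resolvent T \<nu> x)) \<in> T"
    using T resolvent_mem[OF \<mu>] resolvent_mem[OF \<nu>] by (intro linear_operator_diff)
  also have "(x + \<mu> *\<^sub>C resolvent T \<mu> x) - (x + \<nu> *\<^sub>C resolvent T \<nu> x)
      = (\<mu> - \<nu>) *\<^sub>C resolvent T \<nu> x + \<mu> *\<^sub>C (resolvent T \<mu> x - resolvent T \<nu> x)"
    by (simp add: complex_vector.scale_left_diff_distrib complex_vector.scale_right_diff_distrib)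
  finally show ?thesis
    using resolventI[OF \<mu>] resolvent_scaleC[OF \<mu>] by metis
qed

text \<open>
  The resolvent identity bounds \<open>\<parallel>R\<^sub>\<nu> x - R\<^sub>\<mu> x\<parallel>\<close> by \<open>\<bar>\<mu> - \<nu>\<bar> C \<parallel>R\<^sub>\<nu> x\<parallel>\<close> with \<open>C\<close> a bound for
  \<open>R\<^sub>\<mu>\<close>.  Once \<open>\<bar>\<mu> - \<nu>\<bar> C \<le> 1/2\<close>, this also gives \<open>\<parallel>R\<^sub>\<nu> x\<parallel> \<le> 2 \<parallel>R\<^sub>\<mu> x\<parallel>\<close>, so the bound tends
  to zero.
\<close>

lemma resolvent_tendsto:
  assumes T: "linear_operator T" and \<mu>: "\<mu> \<in> resolvent_set T"
    and \<nu>: "\<And>n. \<nu> n \<in> resolvent_set T" "\<nu> \<longlonglongrightarrow> \<mu>"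
  shows "(\<lambda>n. resolvent T (\<nu> n) x) \<longlonglongrightarrow> resolvent T \<mu> x"
proof -
  obtain C where C: "C > 0" "\<And>y. norm (resolvent T \<mu> y) \<le> norm y * C"
    using bounded_linear.pos_bounded[OF bounded_linear_resolvent[OF \<mu>]] by blast
  let ?d = "\<lambda>n. norm (resolvent T (\<nu> n) x - resolvent T \<mu> x)"
  have d: "?d n \<le> cmod (\<mu> - \<nu> n) * C * norm (resolvent T (\<nu> n) x)" for n
  proof -
    have "?d n = cmod (\<mu> - \<nu> n) * norm (resolvent T \<mu> (resolvent T (\<nu> n) x))"
      using resolvent_identity[OF T \<mu> \<nu>(1), of x n] by (simp add: norm_minus_commute norm_scaleC)
    also have "\<dots> \<le> cmod (\<mu> - \<nu> n) * (norm (resolvent T (\<nu> n) x) * C)"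
      by (intro mult_left_mono C) simp
    finally show ?thesis by (simp add: mult_ac)
  qed
  have lim: "(\<lambda>n. cmod (\<mu> - \<nu> n)) \<longlonglongrightarrow> 0"
    using tendsto_norm[OF tendsto_diff[OF tendsto_const[of \<mu>] \<nu>(2)]] by simp
  then have "eventually (\<lambda>n. cmod (\<mu> - \<nu> n) < 1 / (2 * C)) sequentially"
    using C(1) by (intro order_tendstoD) auto
  then have ev: "eventually (\<lambda>n. ?d n \<le> cmod (\<mu> - \<nu> n) * C * (2 * norm (resolvent T \<mu> x))) sequentially"
  proof eventually_elim
    case (elim n)
    have "cmod (\<mu> - \<nu> n) * C \<le> 1 / 2"
      using elim C(1) by (simp add: field_simps)
    then have "?d n \<le> 1 / 2 * norm (resolvent T (\<nu> n) x)"
      using d[of n] by (meson mult_right_mono norm_ge_zero order_trans)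
    moreover have "norm (resolvent T (\<nu> n) x) \<le> norm (resolvent T \<mu> x) + ?d n"
      by (rule norm_triangle_sub)
    ultimately have "norm (resolvent T (\<nu> n) x) \<le> 2 * norm (resolvent T \<mu> x)" by linarith
    then have "cmod (\<mu> - \<nu> n) * C * norm (resolvent T (\<nu> n) x)
        \<le> cmod (\<mu> - \<nu> n) * C * (2 * norm (resolvent T \<mu> x))"
      using C(1) by (intro mult_left_mono) auto
    with d[of n] show ?case by linarith
  qed
  have "(\<lambda>n. resolvent T (\<nu> n) x - resolvent T \<mu> x) \<longlonglongrightarrow> 0"
  proof (rule Lim_null_comparison[OF ev])
    show "(\<lambda>n. cmod (\<mu> - \<nu> n) * C * (2 * norm (resolvent T \<mu> x))) \<longlonglongrightarrow> 0"
      using tendsto_mult_left_zero[OF tendsto_mult_left_zero[OF lim]] .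
  qed
  then show ?thesis by (simp add: LIM_zero_iff)
qed

lemma linear_operator_adjoint_op:
  assumes "densely_defined T"
  shows "linear_operator (adjoint_op T)"
proof -
  have "z = z'" if "(y, z) \<in> adjoint_op T" "(y, z') \<in> adjoint_op T" for y z z'
  proof -
    have "cinner x (z - z') = 0" if "x \<in> Domain T" for x
      using that \<open>(y, z) \<in> adjoint_op T\<close> \<open>(y, z') \<in> adjoint_op T\<close>
      by (auto simp: adjoint_op_def cinner_diff_right)
    then have "z - z' = 0"
      using assms cinner_eq_zeroI_dense unfolding densely_defined_def by metis
    then show ?thesis by simp
  qed
  then show ?thesis
    by (auto simp: linear_operator_def single_valued_def)
      (auto simp: adjoint_op_def cinner_add_right cinner_scaleC_right)
qed

text \<open>
  The bounded adjoint \<open>S\<close> of \<open>(T - \<mu>)\<^sup>-\<^sup>1\<close> inverts \<open>T\<^sup>* - cnj \<mu>\<close>: since \<open>T - \<mu>\<close> is onto with inverse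
  \<open>(T - \<mu>)\<^sup>-\<^sup>1\<close>, the condition defining \<open>(T\<^sup>* - cnj \<mu>) x = y\<close> reads
  \<open>\<langle>v, x\<rangle> = \<langle>(T - \<mu>)\<^sup>-\<^sup>1 v, y\<rangle> = \<langle>v, S y\<rangle>\<close> for all \<open>v\<close>.
\<close>

lemma resolvent_adjoint:
  fixes T :: "'a::chilbert_space operator"
  assumes T: "densely_defined T" and \<mu>: "\<mu> \<in> resolvent_set T"
  shows "cnj \<mu> \<in> resolvent_set (adjoint_op T)"
    and "cinner (resolvent T \<mu> x) y = cinner x (resolvent (adjoint_op T) (cnj \<mu>) y)"
proof -
  obtain S where S: "bounded_linear S" "\<And>x y. resolvent T \<mu> x \<bullet> y = x \<bullet> S y"
    using bounded_linear_adjoint[OF bounded_linear_resolvent[OF \<mu>]] by metis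
  have cS: "cinner (resolvent T \<mu> x) y = cinner x (S y)" for x y
    using S(2)[of x y] S(2)[of "\<i> *\<^sub>C x" y] by (simp add: cinner_conv_inner resolvent_scaleC[OF \<mu>])
  have iff: "(x, y) \<in> adjoint_op T -\<^sub>o cnj \<mu> \<longleftrightarrow> x = S y" for x y
  proof -
    have "(x, y) \<in> adjoint_op T -\<^sub>o cnj \<mu>
        \<longleftrightarrow> (\<forall>u v. (u, v + \<mu> *\<^sub>C u) \<in> T \<longrightarrow> cinner (v + \<mu> *\<^sub>C u) x = cinner u (y + cnj \<mu> *\<^sub>C x))"
      unfolding mem_op_shift_iff adjoint_op_def by (auto) (metis diff_add_cancel)
    also have "\<dots> \<longleftrightarrow> (\<forall>u v. (u, v) \<in> T -\<^sub>o \<mu> \<longrightarrow> cinner v x = cinner u y)"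
      by (simp add: mem_op_shift_iff cinner_add_left cinner_add_right cinner_scaleC_left
          cinner_scaleC_right)
    also have "\<dots> \<longleftrightarrow> (\<forall>v. cinner v x = cinner v (S y))"
      by (simp add: resolvent_iff[OF \<mu>] cS)
    also have "\<dots> \<longleftrightarrow> x = S y"
    proof
      assume "\<forall>v. cinner v x = cinner v (S y)"
      then have "cinner v (x - S y) = 0" for v by (simp add: cinner_diff_right)
      then have "x - S y = 0" using cinner_eq_zeroI_dense[OF closure_UNIV] by blast
      then show "x = S y" by simp
    qed simp
    finally show ?thesis .
  qed
  interpret S: bounded_linear S by (rule S(1))
  have scale: "S (c *\<^sub>C y) = c *\<^sub>C S y" for c y
  proof -
    have "(c *\<^sub>C S y, c *\<^sub>C y) \<in> adjoint_op T -\<^sub>o cnj \<mu>"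
    proof -
      have "(S y, y + cnj \<mu> *\<^sub>C S y) \<in> adjoint_op T"
        using iff mem_op_shift_iff by blast
      then have "(c *\<^sub>C S y, c *\<^sub>C (y + cnj \<mu> *\<^sub>C S y)) \<in> adjoint_op T"
        using linear_operatorD(4)[OF linear_operator_adjoint_op[OF T]] by blast
      then show ?thesis
        by (simp add: mem_op_shift_iff scaleC_add_right scaleC_scaleC mult.commute)
    qed
    then show ?thesis using iff by metis
  qed
  obtain C where C: "\<And>y. norm (S y) \<le> norm y * C"
    using S.bounded by blast
  have "bounded_operator ((adjoint_op T -\<^sub>o cnj \<mu>)\<inverse>)"
    unfolding bounded_operator_def linear_operator_def single_valued_def
    using C by (auto simp: iff S.add S.zero scale mult.commute intro!: exI[of _ C])
  then show *: "cnj \<mu> \<in> resolvent_set (adjoint_op T)"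
    by (simp add: resolvent_set_def)
  show "cinner (resolvent T \<mu> x) y = cinner x (resolvent (adjoint_op T) (cnj \<mu>) y)"
    using cS iff resolvent_iff[OF *] by metis
qed

text \<open>
  Compactness at one point \<open>\<mu>\<close> of the resolvent set spreads to every other point \<open>\<nu>\<close>, because
  \<open>R\<^sub>\<nu> = R\<^sub>\<mu> (1 - (\<mu> - \<nu>) R\<^sub>\<nu>)\<close> by the resolvent identity.
\<close>

lemma compact_map_resolvent:
  assumes T: "linear_operator T" and "has_compact_resolvent T" and \<nu>: "\<nu> \<in> resolvent_set T"
  shows "compact_map (resolvent T \<nu>)"
proof -
  from assms(2) obtain \<mu> where \<mu>: "\<mu> \<in> resolvent_set T"
    and "compact_operator ((T -\<^sub>o \<mu>)\<inverse>)"
    unfolding has_compact_resolvent_def by blast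
  moreover have "(T -\<^sub>o \<mu>)\<inverse> `` cball 0 1 = resolvent T \<mu> ` cball 0 1"
    using resolvent_iff[OF \<mu>] by auto
  ultimately have cpt: "compact (closure (resolvent T \<mu> ` cball 0 1))"
    by (simp add: compact_operator_def)
  interpret R: bounded_linear "resolvent T \<mu>" by (rule bounded_linear_resolvent[OF \<mu>])
  have comp: "compact_map (resolvent T \<mu>)"
    unfolding compact_map_def
  proof (intro allI impI)
    fix x :: "nat \<Rightarrow> 'a" assume "bounded (range x)"
    then obtain C where C: "C > 0" "\<And>n. norm (x n) \<le> C"
      unfolding bounded_pos by auto
    then have "\<forall>n. resolvent T \<mu> (x n /\<^sub>R C) \<in> closure (resolvent T \<mu> ` cball 0 1)"
      by (intro allI closure_subset[THEN subsetD] imageI) (simp add: field_simps)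
    then obtain l r where r: "strict_mono (r :: nat \<Rightarrow> nat)"
      and "((\<lambda>n. resolvent T \<mu> (x n /\<^sub>R C)) \<circ> r) \<longlonglongrightarrow> l"
      using cpt unfolding compact_def by metis
    then have "(\<lambda>n. C *\<^sub>R resolvent T \<mu> (x (r n) /\<^sub>R C)) \<longlonglongrightarrow> C *\<^sub>R l"
      by (intro tendsto_intros) (simp add: o_def)
    with C(1) have "(\<lambda>n. resolvent T \<mu> (x (r n))) \<longlonglongrightarrow> C *\<^sub>R l"
      by (simp add: R.scaleR)
    with r show "\<exists>r. strict_mono r \<and> convergent (\<lambda>n. resolvent T \<mu> (x (r n)))"
      unfolding convergent_def by blast
  qed
  have "bounded_linear (\<lambda>x. x - (\<mu> - \<nu>) *\<^sub>C resolvent T \<nu> x)"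
    by (intro bounded_linear_sub bounded_linear_ident
        bounded_linear_compose[OF bounded_linear_scaleC bounded_linear_resolvent[OF \<nu>]])
  from compact_map_comp[OF comp this]
  have "compact_map (\<lambda>x. resolvent T \<mu> (x - (\<mu> - \<nu>) *\<^sub>C resolvent T \<nu> x))" .
  moreover have "resolvent T \<mu> (x - (\<mu> - \<nu>) *\<^sub>C resolvent T \<nu> x) = resolvent T \<nu> x" for x
    by (simp add: R.diff resolvent_scaleC[OF \<mu>] flip: resolvent_identity[OF T \<mu> \<nu>])
  ultimately show ?thesis by simp
qed

section \<open>The unobservable subspace\<close>

text \<open>
  For \<open>y \<in> D(B)\<close> and \<open>u \<in> D(B\<^sup>*)\<close> we have \<open>\<langle>B y, u\<rangle> = \<langle>y, B\<^sup>* u\<rangle>\<close>, and \<open>D(B\<^sup>*)\<close> is dense because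
  it contains \<open>D(B)\<close>.  The right-hand side is stable under limits, whereas \<open>ker B\<close> alone need
  not be closed.
\<close>

lemma symmetric_operator_ker_iff:
  assumes B: "symmetric_operator B" and y: "y \<in> Domain B"
  shows "(y, 0) \<in> B \<longleftrightarrow> (\<forall>u w. (u, w) \<in> adjoint_op B \<longrightarrow> cinner w y = 0)"
proof
  assume "(y, 0) \<in> B"
  then have "cinner 0 u = cinner y w" if "(u, w) \<in> adjoint_op B" for u w
    using that unfolding adjoint_op_def by blast
  then have "cinner y w = 0" if "(u, w) \<in> adjoint_op B" for u w
    using that by simp
  then show "\<forall>u w. (u, w) \<in> adjoint_op B \<longrightarrow> cinner w y = 0"
    using cinner_eq_0_commute by blast
next
  assume orth: "\<forall>u w. (u, w) \<in> adjoint_op B \<longrightarrow> cinner w y = 0"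
  from y obtain b where b: "(y, b) \<in> B" by blast
  have sym: "cinner w y = cinner u b" if "(u, w) \<in> B" for u w
    using B that b unfolding symmetric_operator_def by blast
  have "B \<subseteq> adjoint_op B"
    using B unfolding symmetric_operator_def adjoint_op_def by blast
  then have "cinner u b = 0" if "u \<in> Domain B" for u
    using orth sym that by fastforce
  then have "b = 0"
    using B cinner_eq_zeroI_dense unfolding symmetric_operator_def densely_defined_def by metis
  with b show "(y, 0) \<in> B" by simp
qed

text \<open>
  The name is that of control theory: these are the states of the system governed by \<open>A\<^sup>*\<close> that
  the output \<open>B\<close> does not detect at any frequency \<open>t\<close>.
\<close>

definition unobservable :: "'a::complex_inner operator \<Rightarrow> 'a operator \<Rightarrow> 'a set" where
  "unobservable A B = {x. \<forall>t::real. (resolvent (adjoint_op A) (- (\<i> * complex_of_real t)) x, 0) \<in> B}"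

locale symmetric_output =
  fixes A B :: "'a::chilbert_space operator"
  assumes lin_A: "linear_operator A" and dense_A: "densely_defined A"
    and imag: "\<And>t::real. \<i> * complex_of_real t \<in> resolvent_set A"
    and sym_B: "symmetric_operator B"
    and dom: "Domain (adjoint_op A) \<subseteq> Domain B"
begin

abbreviation "R t \<equiv> resolvent A (\<i> * complex_of_real t)"
abbreviation "S t \<equiv> resolvent (adjoint_op A) (- (\<i> * complex_of_real t))"

lemma imag_adjoint: "- (\<i> * complex_of_real t) \<in> resolvent_set (adjoint_op A)"
  using resolvent_adjoint(1)[OF dense_A imag[of t]] by simp

lemma cinner_R: "cinner (R t x) y = cinner x (S t y)"
  using resolvent_adjoint(2)[OF dense_A imag[of t], of x y] by simp

lemma lin_adjoint: "linear_operator (adjoint_op A)"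
  using dense_A by (rule linear_operator_adjoint_op)

lemma lin_B: "linear_operator B"
  using sym_B by (simp add: symmetric_operator_def)

lemma S_ker_iff: "(S t x, 0) \<in> B \<longleftrightarrow> (\<forall>u w. (u, w) \<in> adjoint_op B \<longrightarrow> cinner w (S t x) = 0)"
  using symmetric_operator_ker_iff[OF sym_B] resolvent_mem[OF imag_adjoint[of t], of x] dom by blast

lemma unobservable_iff:
  "x \<in> unobservable A B \<longleftrightarrow> (\<forall>t u w. (u, w) \<in> adjoint_op B \<longrightarrow> cinner (R t w) x = 0)"
  by (simp add: unobservable_def S_ker_iff cinner_R)

lemma Inter_ker_eq_unobservable:
  "(\<Inter>t::real. op_ker (B \<circ>\<^sub>o (adjoint_op A -\<^sub>o (- (\<i> * complex_of_real t)))\<inverse>)) = unobservable A B"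
  by (auto simp: op_ker_def op_comp_def unobservable_def relcomp_unfold
      resolvent_iff[OF imag_adjoint])

lemma zero_unobservable: "0 \<in> unobservable A B"
  by (auto simp: unobservable_iff)

lemma dense_iff_unobservable_trivial:
  "closure (complex_vector.span
      {x. \<exists>t::real. \<exists>u \<in> Domain (adjoint_op B).
        (u, x) \<in> (A -\<^sub>o (\<i> * complex_of_real t))\<inverse> \<circ>\<^sub>o adjoint_op B}) = UNIV
    \<longleftrightarrow> unobservable A B = {0}"
proof -
  have "{x. \<exists>t::real. \<exists>u \<in> Domain (adjoint_op B).
        (u, x) \<in> (A -\<^sub>o (\<i> * complex_of_real t))\<inverse> \<circ>\<^sub>o adjoint_op B}
      = {R t w | t u w. (u, w) \<in> adjoint_op B}"
    using resolvent_iff[OF imag] by (fastforce simp: op_comp_def)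
  moreover have "(\<forall>w\<in>{R t w | t u w. (u, w) \<in> adjoint_op B}. cinner w x = 0)
      \<longleftrightarrow> x \<in> unobservable A B" for x
    unfolding unobservable_iff by blast
  ultimately show ?thesis
    unfolding dense_span_iff using zero_unobservable by auto
qed

lemma unobservable_trivial_if_ker_trivial:
  assumes "op_ker B = {0}"
  shows "unobservable A B = {0}"
proof -
  have "x = 0" if "x \<in> unobservable A B" for x
  proof -
    have "S 0 x = 0"
      using that assms unfolding unobservable_def op_ker_def by blast
    then have "(0, x) \<in> adjoint_op A"
      using resolvent_mem[OF imag_adjoint[of 0], of x] by simp
    then show ?thesis
      using linear_operatorD(1,2)[OF lin_adjoint] by blast
  qed
  with zero_unobservable show ?thesis by blast
qed

text \<open>
  From \<open>A\<^sup>* y = \<mu> y\<close> we get \<open>y = (\<mu> + it) S\<^sub>t y\<close>, so \<open>S\<^sub>t y\<close> is a multiple of \<open>y\<close>.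
\<close>

lemma eigenvector_unobservable:
  assumes y: "(y, \<mu> *\<^sub>C y) \<in> adjoint_op A" "(y, 0) \<in> B"
  shows "y \<in> unobservable A B"
  unfolding unobservable_def
proof (intro CollectI allI)
  fix t :: real
  let ?c = "\<mu> + \<i> * complex_of_real t"
  have "y = S t (?c *\<^sub>C y)"
    using y(1) by (intro resolventI imag_adjoint) (simp add: scaleC_add_left)
  also have "\<dots> = ?c *\<^sub>C S t y"
    by (rule resolvent_scaleC[OF imag_adjoint])
  finally have eq: "?c *\<^sub>C S t y = y" by (rule sym)
  show "(S t y, 0) \<in> B"
  proof (cases "?c = 0")
    case True
    \<comment> \<open>A nonzero \<open>y\<close> would be an eigenvector for \<open>-it\<close>, a point of the resolvent set.\<close>
    have "y = 0" using eq unfolding True by simp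
    then show ?thesis
      using y(2) bounded_linear.linear[OF bounded_linear_resolvent[OF imag_adjoint], THEN linear_0, of t]
      by simp
  next
    case False
    have "S t y = (inverse ?c * ?c) *\<^sub>C S t y"
      using left_inverse[OF False] by simp
    also have "\<dots> = inverse ?c *\<^sub>C y"
      by (simp only: eq flip: scaleC_scaleC)
    finally show ?thesis
      using linear_operatorD(4)[OF lin_B y(2), of "inverse ?c"] by simp
  qed
qed

text \<open>
  A nonzero \<open>y\<close> with \<open>A\<^sup>* y = \<mu> y\<close> puts \<open>\<mu>\<close> into the point spectrum, so (iv) may quantify over all
  complex \<open>\<mu>\<close>.
\<close>

lemma no_eigenvector_iff:
  "(\<forall>\<mu> \<in> point_spectrum (adjoint_op A). op_ker B \<inter> op_ker (adjoint_op A -\<^sub>o \<mu>) = {0})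
   \<longleftrightarrow> (\<forall>\<mu> y. (y, \<mu> *\<^sub>C y) \<in> adjoint_op A \<longrightarrow> (y, 0) \<in> B \<longrightarrow> y = 0)"
  using linear_operatorD(2)[OF lin_B] linear_operatorD(2)[OF lin_adjoint]
  by (fastforce simp: op_ker_def mem_op_shift_iff point_spectrum_def)

lemma scaleC_unobservable:
  "x \<in> unobservable A B \<Longrightarrow> c *\<^sub>C x \<in> unobservable A B"
  by (auto simp: unobservable_iff cinner_scaleC_right)

lemma subspace_unobservable: "subspace (unobservable A B)"
proof (rule subspaceI)
  show "x + y \<in> unobservable A B" if "x \<in> unobservable A B" "y \<in> unobservable A B" for x y
    using that by (simp add: unobservable_iff cinner_add_right)
  show "c *\<^sub>R x \<in> unobservable A B" if "x \<in> unobservable A B" for c x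
    using scaleC_unobservable[OF that, of "complex_of_real c"] by (simp only: scaleC_of_real)
qed (rule zero_unobservable)

lemma closed_unobservable: "closed (unobservable A B)"
proof -
  have "unobservable A B = (\<Inter>t. \<Inter>p\<in>adjoint_op B. {x. cinner x (R t (snd p)) = 0})"
    by (auto simp: unobservable_iff cinner_eq_0_commute[of "resolvent _ _ _"]) fastforce
  moreover have "closed {x. cinner x (R t w) = 0}" for t w
    by (intro closed_Collect_eq continuous_intros
        linear_continuous_on bounded_linear_cinner_left)
  ultimately show ?thesis by (auto intro!: closed_INT)
qed

text \<open>
  For \<open>t \<noteq> 0\<close> the resolvent identity writes \<open>S\<^sub>t S\<^sub>0 x\<close> as a multiple of \<open>S\<^sub>t x - S\<^sub>0 x\<close>, which lies
  in \<open>ker B\<close>.  For \<open>t = 0\<close> we pass to the limit: membership of \<open>S\<^sub>0 S\<^sub>0 x\<close> in \<open>ker B\<close> is an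
  orthogonality relation, hence stable under limits.
\<close>

lemma unobservable_invariant:
  assumes x: "x \<in> unobservable A B"
  shows "S 0 x \<in> unobservable A B"
proof -
  have ker: "(S t (S 0 x), 0) \<in> B" if "t \<noteq> 0" for t
  proof -
    let ?c = "- (\<i> * complex_of_real t)"
    have c0: "?c \<noteq> 0" using that by simp
    have "S t x - S 0 x = ?c *\<^sub>C S t (S 0 x)"
      using resolvent_identity[OF lin_adjoint imag_adjoint[of t] imag_adjoint[of 0]] by simp
    then have "inverse ?c *\<^sub>C (S t x - S 0 x) = inverse ?c *\<^sub>C ?c *\<^sub>C S t (S 0 x)"
      by metis
    also have "\<dots> = (inverse ?c * ?c) *\<^sub>C S t (S 0 x)"
      by (rule scaleC_scaleC)
    also have "inverse ?c * ?c = 1"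
      using c0 by (rule left_inverse)
    finally have eq: "inverse ?c *\<^sub>C (S t x - S 0 x) = S t (S 0 x)" by simp
    have "(S t x - S 0 x, 0 - 0) \<in> B"
      using x unfolding unobservable_def
      by (intro linear_operator_diff lin_B) blast+
    from linear_operatorD(4)[OF lin_B this, of "inverse ?c"] show ?thesis
      unfolding eq by simp
  qed
  have "(S 0 (S 0 x), 0) \<in> B"
    unfolding S_ker_iff
  proof safe
    fix u w assume uw: "(u, w) \<in> adjoint_op B"
    let ?t = "\<lambda>n. 1 / real (Suc n)"
    have "?t \<longlonglongrightarrow> 0"
      using LIMSEQ_inverse_real_of_nat by (simp add: inverse_eq_divide)
    then have "(\<lambda>n. - (\<i> * complex_of_real (?t n))) \<longlonglongrightarrow> - (\<i> * complex_of_real 0)"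
      by (intro tendsto_intros)
    then have lim: "(\<lambda>n. S (?t n) (S 0 x)) \<longlonglongrightarrow> S 0 (S 0 x)"
      by (intro resolvent_tendsto lin_adjoint imag_adjoint)
    have "(\<lambda>n. cinner (S (?t n) (S 0 x)) w) \<longlonglongrightarrow> cinner (S 0 (S 0 x)) w"
      by (rule bounded_linear.tendsto[OF bounded_linear_cinner_left lim])
    moreover have "cinner (S (?t n) (S 0 x)) w = 0" for n
    proof -
      have "cinner w (S (?t n) (S 0 x)) = 0"
        using ker[of "?t n"] uw unfolding S_ker_iff by auto
      then show ?thesis by (rule cinner_eq_0_commute[THEN iffD1])
    qed
    ultimately have "cinner (S 0 (S 0 x)) w = 0"
      by (simp add: LIMSEQ_const_iff)
    then show "cinner w (S 0 (S 0 x)) = 0" by (rule cinner_eq_0_commute[THEN iffD1])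
  qed
  with ker have "(S t (S 0 x), 0) \<in> B" for t
    by (cases "t = 0") simp_all
  then show ?thesis
    by (simp only: unobservable_def mem_Collect_eq) blast
qed

lemma compact_map_S0:
  assumes "has_compact_resolvent A"
  shows "compact_map (S 0)"
proof (rule compact_map_adjoint)
  show "compact_map (R 0)" by (rule compact_map_resolvent[OF lin_A assms imag])
  show "bounded_linear (S 0)" by (rule bounded_linear_resolvent[OF imag_adjoint])
  show "R 0 x \<bullet> y = x \<bullet> S 0 y" for x y
    using cinner_R[of 0 x y] by (simp only: flip: Re_cinner)
qed

text \<open>
  By the Fredholm alternative, only injectivity of \<open>1 - \<mu> S\<^sub>0\<close> on the unobservable subspace is to
  be shown.  A vector \<open>z\<close> with \<open>z = \<mu> S\<^sub>0 z\<close> yields \<open>A\<^sup>* (S\<^sub>0 z) = z = \<mu> S\<^sub>0 z\<close> and \<open>B S\<^sub>0 z = 0\<close>.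
\<close>

lemma unobservable_surjective:
  assumes cpt: "has_compact_resolvent A"
    and iv: "\<forall>\<mu> y. (y, \<mu> *\<^sub>C y) \<in> adjoint_op A \<longrightarrow> (y, 0) \<in> B \<longrightarrow> y = 0"
    and y: "y \<in> unobservable A B"
  obtains z where "z \<in> unobservable A B" "z - \<mu> *\<^sub>C S 0 z = y"
proof -
  let ?K = "\<lambda>z. S 0 (\<mu> *\<^sub>C z)"
  have K: "?K z = \<mu> *\<^sub>C S 0 z" for z
    by (rule resolvent_scaleC[OF imag_adjoint])
  have bl: "bounded_linear (\<lambda>x::'a. \<mu> *\<^sub>C x)"
    by (rule bounded_linear_scaleC)
  have "bounded_linear ?K"
    by (rule bounded_linear_compose[OF bounded_linear_resolvent[OF imag_adjoint] bl])
  moreover have "compact_map ?K"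
    by (rule compact_map_comp[OF compact_map_S0[OF cpt] bl])
  moreover have "?K ` unobservable A B \<subseteq> unobservable A B"
  proof safe
    fix z assume "z \<in> unobservable A B"
    then have "\<mu> *\<^sub>C z \<in> unobservable A B" by (rule scaleC_unobservable)
    then show "?K z \<in> unobservable A B" by (rule unobservable_invariant)
  qed
  moreover have "z = 0" if z: "z \<in> unobservable A B" "?K z = z" for z
  proof -
    have "(S 0 z, z) \<in> adjoint_op A"
      using resolvent_mem[OF imag_adjoint[of 0], of z] by simp
    then have "(S 0 z, \<mu> *\<^sub>C S 0 z) \<in> adjoint_op A"
      using z(2) K by metis
    moreover have "(S 0 z, 0) \<in> B"
      using z(1) unfolding unobservable_def by blast
    ultimately have "S 0 z = 0" using iv by blast
    then show "z = 0" using z(2) K by simp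
  qed
  ultimately obtain z where "z \<in> unobservable A B" "z - ?K z = y"
    using fredholm_surjective[OF _ _ subspace_unobservable closed_unobservable _ _ y] by metis
  then show thesis using that K by metis
qed

text \<open>
  Induction along the chain \<open>v, (A - \<mu>) v, \<dots>, 0\<close>; the step replaces \<open>x\<close> by a preimage \<open>z\<close> under
  \<open>1 - cnj \<mu> S\<^sub>0\<close> and moves this operator to the other side of the inner product.
\<close>

lemma generalised_eigenvector_orthogonal:
  assumes cpt: "has_compact_resolvent A"
    and iv: "\<forall>\<mu> y. (y, \<mu> *\<^sub>C y) \<in> adjoint_op A \<longrightarrow> (y, 0) \<in> B \<longrightarrow> y = 0"
    and "(v, 0) \<in> (A -\<^sub>o \<mu>) ^^ n" and "x \<in> unobservable A B"
  shows "cinner v x = 0"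
  using assms(3,4)
proof (induction n arbitrary: v x)
  case 0
  then show ?case by simp
next
  case (Suc n)
  from Suc.prems(1) obtain w where w: "(v, w) \<in> A -\<^sub>o \<mu>" "(w, 0) \<in> (A -\<^sub>o \<mu>) ^^ n"
    by (blast elim: relpow_Suc_E2)
  obtain z where z: "z \<in> unobservable A B" "z - cnj \<mu> *\<^sub>C S 0 z = x"
    using unobservable_surjective[OF cpt iv Suc.prems(2)] by metis
  have "v = R 0 (w + \<mu> *\<^sub>C v)"
    using w(1) by (intro resolventI imag) (simp add: mem_op_shift_iff)
  then have "cinner v z = cinner (w + \<mu> *\<^sub>C v) (S 0 z)"
    using cinner_R by metis
  moreover have "cinner w (S 0 z) = 0"
    using Suc.IH[OF w(2)] unobservable_invariant[OF z(1)] by blast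
  ultimately have "cinner v (z - cnj \<mu> *\<^sub>C S 0 z) = 0"
    by (simp add: cinner_diff_right cinner_scaleC_right cinner_add_left cinner_scaleC_left)
  with z(2) show ?case by simp
qed

lemma unobservable_trivial_if_no_eigenvector:
  assumes cpt: "has_compact_resolvent A" and complete: "complete_generalised_eigenvectors A"
    and iv: "\<forall>\<mu> y. (y, \<mu> *\<^sub>C y) \<in> adjoint_op A \<longrightarrow> (y, 0) \<in> B \<longrightarrow> y = 0"
  shows "unobservable A B = {0}"
proof -
  have "x = 0" if "x \<in> unobservable A B" for x
  proof -
    have "\<forall>v\<in>generalised_eigenvectors A. cinner v x = 0"
      using generalised_eigenvector_orthogonal[OF cpt iv _ that]
      unfolding generalised_eigenvectors_def op_ker_def by blast
    with complete show ?thesis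
      unfolding complete_generalised_eigenvectors_def dense_span_iff by blast
  qed
  with zero_unobservable show ?thesis by blast
qed

end

theorem proposition5p4:
  fixes A B :: "'a::chilbert_space operator"
  assumes "closed_operator A" and "densely_defined A"
    and "\<forall>t::real. \<i> * complex_of_real t \<in> resolvent_set A"
    and "symmetric_operator B"
    and "Domain (adjoint_op A) \<subseteq> Domain B"
  shows
    "let
       i = (op_ker B = {0});
       ii = ((\<Inter>t::real. op_ker (B \<circ>\<^sub>o (adjoint_op A -\<^sub>o (- (\<i> * complex_of_real t)))\<inverse>)) = {0});
       iii = (closure (complex_vector.span
                {x. \<exists>t::real. \<exists>u \<in> Domain (adjoint_op B).
                  (u, x) \<in> (A -\<^sub>o (\<i> * complex_of_real t))\<inverse> \<circ>\<^sub>o adjoint_op B}) = UNIV);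
       iv = (\<forall>\<mu> \<in> point_spectrum (adjoint_op A).
               op_ker B \<inter> op_ker (adjoint_op A -\<^sub>o \<mu>) = {0})
     in (i \<longrightarrow> ii) \<and> (ii \<longleftrightarrow> iii) \<and> (iii \<longrightarrow> iv) \<and>
        (has_compact_resolvent A \<and> complete_generalised_eigenvectors A \<longrightarrow> (iii \<longleftrightarrow> iv))"
proof -
  interpret symmetric_output A B
    using assms by unfold_locales (auto simp: closed_operator_def)
  show ?thesis
    unfolding Let_def Inter_ker_eq_unobservable dense_iff_unobservable_trivial no_eigenvector_iff
    using unobservable_trivial_if_ker_trivial eigenvector_unobservable
      unobservable_trivial_if_no_eigenvector
    by blast
qed

end
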